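(* Let $f:\mathbb H^+\to\mathbb H^+$ be a slice regular function. If there exists a sequence $\{q_n\}_{n\in\mathbb N}\subset\mathcal S_\gamma$ for some $\gamma\in(0,1)$ converging to $\infty$ as $n\to\infty$, such that $$f(q_n)=q_n+o\Big(\frac1{q_n}\Big)\qquad\text{as }n\to\infty,$$ then $f(q)=q$ for all $q\in\mathbb H^+$.
   Context: $\mathbb H$ is the algebra of quaternions, $\mathbb H^+=\{q\in\mathbb H:\mathrm{Re}(q)>0\}$, $\mathbb S=\{q\in\mathbb H:q^2=-1\}$, and $\mathbb C_I=\mathbb R\oplus I\mathbb R$ for $I\in\mathbb S$. A function $f$ on a domain $\Omega\subseteq\mathbb H$ is slice regular if for every $I\in\mathbb S$ its restriction $f_I$ to $\Omega\cap\mathbb C_I$ has continuous partial derivatives and satisfies $\frac12\left(\frac{\partial}{\partial x}+I\frac{\partial}{\partial y}\right)f_I(x+yI)=0$. For $\gamma\in(0,1)$, $\mathcal S_\gamma=\{q\in\mathbb H^+:\mathrm{Re}(q)>\gamma|q|\}$. Convergence $q_n\to\infty$ means $|q_n|\to\infty$, and the $o$-condition means $|q_n|\,|f(q_n)-q_n|\to0$. *)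

theory Defs
  imports "HOL-Analysis.Analysis"
begin

codatatype quat = Quat (qre: real) (qi: real) (qj: real) (qk: real)

lemma quat_eqI [intro?]:
  "qre p = qre q \<Longrightarrow> qi p = qi q \<Longrightarrow> qj p = qj q \<Longrightarrow> qk p = qk q \<Longrightarrow> p = q"
  by (rule quat.expand) simp

lemma quat_eq_iff:
  "p = q \<longleftrightarrow> qre p = qre q \<and> qi p = qi q \<and> qj p = qj q \<and> qk p = qk q"
  by (auto intro: quat_eqI)

instantiation quat :: ring_1
begin

primcorec zero_quat :: quat
  where "qre 0 = 0" | "qi 0 = 0" | "qj 0 = 0" | "qk 0 = 0"

primcorec one_quat :: quat
  where "qre 1 = 1" | "qi 1 = 0" | "qj 1 = 0" | "qk 1 = 0"

primcorec plus_quat :: "quat \<Rightarrow> quat \<Rightarrow> quat"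
  where
    "qre (p + q) = qre p + qre q"
  | "qi (p + q) = qi p + qi q"
  | "qj (p + q) = qj p + qj q"
  | "qk (p + q) = qk p + qk q"

primcorec uminus_quat :: "quat \<Rightarrow> quat"
  where
    "qre (- q) = - qre q"
  | "qi (- q) = - qi q"
  | "qj (- q) = - qj q"
  | "qk (- q) = - qk q"

primcorec minus_quat :: "quat \<Rightarrow> quat \<Rightarrow> quat"
  where
    "qre (p - q) = qre p - qre q"
  | "qi (p - q) = qi p - qi q"
  | "qj (p - q) = qj p - qj q"
  | "qk (p - q) = qk p - qk q"

text \<open>The Hamilton product: \<open>i\<^sup>2 = j\<^sup>2 = k\<^sup>2 = -1\<close>, \<open>i j = k\<close>, \<open>j k = i\<close>, \<open>k i = j\<close>.\<close>

primcorec times_quat :: "quat \<Rightarrow> quat \<Rightarrow> quat"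
  where
    "qre (p * q) = qre p * qre q - qi p * qi q - qj p * qj q - qk p * qk q"
  | "qi (p * q) = qre p * qi q + qi p * qre q + qj p * qk q - qk p * qj q"
  | "qj (p * q) = qre p * qj q - qi p * qk q + qj p * qre q + qk p * qi q"
  | "qk (p * q) = qre p * qk q + qi p * qj q - qj p * qi q + qk p * qre q"

instance
  by standard (simp_all add: quat_eq_iff algebra_simps)

end

instantiation quat :: real_algebra_1
begin

primcorec scaleR_quat :: "real \<Rightarrow> quat \<Rightarrow> quat"
  where
    "qre (scaleR r q) = r * qre q"
  | "qi (scaleR r q) = r * qi q"
  | "qj (scaleR r q) = r * qj q"
  | "qk (scaleR r q) = r * qk q"

instance
  by standard (simp_all add: quat_eq_iff algebra_simps)

end

instantiation quat :: real_inner
begin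

definition inner_quat :: "quat \<Rightarrow> quat \<Rightarrow> real"
  where "inner_quat p q = qre p * qre q + qi p * qi q + qj p * qj q + qk p * qk q"

definition norm_quat :: "quat \<Rightarrow> real"
  where "norm_quat q = sqrt (inner q q)"

definition sgn_quat :: "quat \<Rightarrow> quat"
  where "sgn_quat q = q /\<^sub>R norm q"

definition dist_quat :: "quat \<Rightarrow> quat \<Rightarrow> real"
  where "dist_quat p q = norm (p - q)"

definition uniformity_quat :: "(quat \<times> quat) filter"
  where "uniformity_quat = (INF e\<in>{0 <..}. principal {(p, q). dist p q < e})"

definition open_quat :: "quat set \<Rightarrow> bool"
  where "open_quat U \<longleftrightarrow> (\<forall>x\<in>U. eventually (\<lambda>(x', y). x' = x \<longrightarrow> y \<in> U) uniformity)"

instance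
proof
  fix p q s :: quat and r :: real
  show "inner p q = inner q p" "inner (p + q) s = inner p s + inner q s"
    "inner (r *\<^sub>R p) q = r * inner p q"
    by (simp_all add: inner_quat_def algebra_simps)
  show "0 \<le> inner p p"
    by (simp add: inner_quat_def)
  show "inner p p = 0 \<longleftrightarrow> p = 0"
    by (auto simp: inner_quat_def quat_eq_iff add_nonneg_eq_0_iff)
qed (simp_all add: norm_quat_def sgn_quat_def dist_quat_def uniformity_quat_def open_quat_def)

end

lemma norm_quat_eq: "norm q = sqrt ((qre q)\<^sup>2 + (qi q)\<^sup>2 + (qj q)\<^sup>2 + (qk q)\<^sup>2)"
  by (simp add: norm_quat_def inner_quat_def power2_eq_square)

instantiation quat :: real_normed_div_algebra
begin

primcorec inverse_quat :: "quat \<Rightarrow> quat"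
  where
    "qre (inverse q) = qre q / (norm q)\<^sup>2"
  | "qi (inverse q) = - qi q / (norm q)\<^sup>2"
  | "qj (inverse q) = - qj q / (norm q)\<^sup>2"
  | "qk (inverse q) = - qk q / (norm q)\<^sup>2"

definition divide_quat :: "quat \<Rightarrow> quat \<Rightarrow> quat"
  where "divide_quat p q = p * inverse q"

instance
proof
  fix p q :: quat
  have sq: "(norm p)\<^sup>2 = qre p * qre p + qi p * qi p + qj p * qj p + qk p * qk p" for p
    by (simp add: norm_quat_eq power2_eq_square)
  show "p div q = p * inverse q"
    by (simp add: divide_quat_def)
  show "inverse (0::quat) = 0"
    by (simp add: quat_eq_iff)
  assume "p \<noteq> 0"
  then have "(norm p)\<^sup>2 \<noteq> 0"
    by simp
  then show "inverse p * p = 1" "p * inverse p = 1"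
    by (simp_all add: quat_eq_iff field_simps) (simp_all add: sq)
next
  fix p q :: quat
  show "norm (p * q) = norm p * norm q"
    unfolding norm_quat_eq real_sqrt_mult [symmetric]
    by (rule arg_cong [where f = sqrt]) (simp add: power2_eq_square algebra_simps)
qed

end

definition imag_units :: "quat set"
  where "imag_units = {q. q\<^sup>2 = -1}"

definition slice_pt :: "quat \<Rightarrow> real \<Rightarrow> real \<Rightarrow> quat"
  where "slice_pt I x y = of_real x + of_real y * I"

text \<open>
  The set \<open>\<Omega>\<close> is meant to be a domain, so that the parameter set \<open>D\<close> of each slice is open in
  the plane and the unrestricted derivatives below depend only on the values of \<open>f\<close> on \<open>\<Omega>\<close>.
  The witnesses \<open>fx\<close> and \<open>fy\<close> are the partial derivatives of \<open>(x, y) \<mapsto> f (x + y I)\<close>.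
  The unit \<open>I\<close> multiplies from the left.
\<close>

definition slice_regular_on :: "(quat \<Rightarrow> quat) \<Rightarrow> quat set \<Rightarrow> bool"
  where
    "slice_regular_on f \<Omega> \<longleftrightarrow>
      (\<forall>I\<in>imag_units. let D = {(x, y). slice_pt I x y \<in> \<Omega>} in
        \<exists>fx fy :: real \<times> real \<Rightarrow> quat.
          continuous_on D fx \<and> continuous_on D fy \<and>
          (\<forall>(x, y)\<in>D.
            ((\<lambda>t. f (slice_pt I t y)) has_vector_derivative fx (x, y)) (at x) \<and>
            ((\<lambda>t. f (slice_pt I x t)) has_vector_derivative fy (x, y)) (at y) \<and>
            (1 / 2) *\<^sub>R (fx (x, y) + I * fy (x, y)) = 0))"

definition right_half_space :: "quat set"
  where "right_half_space = {q. qre q > 0}"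

definition sector :: "real \<Rightarrow> quat set"
  where "sector \<gamma> = {q \<in> right_half_space. qre q > \<gamma> * norm q}"

end

theory Submission imports Defs "HOL-Complex_Analysis.Complex_Analysis" begin

text \<open>
  For a holomorphic self-map \<open>F\<close> of the complex right half plane, the analogous statement follows
  from the Schwarz-Pick inequality

    \<open>\<bar>F z - F w\<bar>\<^sup>2 Re z Re w \<le> \<bar>z - w\<bar>\<^sup>2 Re (F z) Re (F w)\<close>

  in two steps. If \<open>F(z\<^sub>n) - z\<^sub>n \<rightarrow> 0\<close> in a sector, then putting \<open>w = z\<^sub>n\<close> and letting
  \<open>n \<rightarrow> \<infinity>\<close> gives \<open>Re (F z) \<ge> Re z\<close> (Julia's lemma at infinity with dilation coefficient 1).
  So \<open>H z = F z - z\<close> has nonnegative real part, and Harnack's inequality shows that such a real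
  part decays no faster than \<open>1 / \<bar>z\<bar>\<close> in a sector unless it vanishes; hence \<open>H\<close> is constant,
  and the constant is \<open>0\<close>.

  For a slice regular \<open>f\<close> and an imaginary unit \<open>I\<close>, the projection of \<open>f\<close> to the plane of \<open>I\<close>
  is a holomorphic self-map of the half plane (\<open>slice_regular_on_holomorphic\<close>). The obstacle is
  that the \<open>q\<^sub>n\<close> may lie in different slices, so that no single slice sees the hypothesis. It is
  overcome by comparing \<open>q\<^sub>n\<close>, inside its own slice, with a fixed point \<open>x\<close> of the positive real
  axis: this point lies in all slices, and the real part of the projection at \<open>x\<close> is
  \<open>Re (f x)\<close> for all of them. Both inequalities are uniform in the slice and so survive
  the limit (\<open>Re_ge_of_tangent_sequence\<close> and \<open>Re_eq_0_of_fast_decay\<close>).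

  Concretely, the first gives \<open>Re (f x) \<ge> x\<close> on the positive real axis, and from there Julia's
  argument inside each slice gives \<open>Re (f p) \<ge> Re p\<close> everywhere (\<open>Re_ge_of_Re_ge_on_reals\<close>). The
  second, applied to \<open>g p = f p - p\<close>, gives \<open>Re (g x) = 0\<close> on the positive real axis. By
  Schwarz-Pick, the vanishing real part makes the projection of \<open>g\<close> to every slice constant, so \<open>g\<close> is constant on
  the positive real axis, and by the identity theorem on the whole half space. The constant is
  the limit of \<open>g (q\<^sub>n)\<close>, which is \<open>0\<close>.
\<close>

section \<open>Schwarz-Pick and Julia inequalities on the half plane\<close>

abbreviation halfplane :: "complex set"
  where "halfplane \<equiv> {z. 0 < Re z}"

text \<open>
  The pseudo-hyperbolic distance of the half plane is \<open>\<bar>z - w\<bar> / \<bar>z + cnj w\<bar>\<close>. This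
  identity trades its denominator for \<open>Re z * Re w\<close>, which puts Schwarz-Pick into a form
  without quotients.
\<close>

lemma norm_add_cnj_sq: "(norm (z + cnj w))\<^sup>2 = (norm (z - w))\<^sup>2 + 4 * Re z * Re w"
  unfolding cmod_power2 by (simp add: power2_eq_square algebra_simps)

lemma add_cnj_nonzero: "0 < Re z \<Longrightarrow> 0 < Re w \<Longrightarrow> z + cnj w \<noteq> 0"
  by (auto simp: complex_eq_iff)

text \<open>
  The Schwarz lemma, transported by the Cayley maps that send \<open>w\<close> and \<open>F w\<close> to \<open>0\<close>.
\<close>

lemma Schwarz_Pick_halfplane_strict:
  assumes hol: "F holomorphic_on halfplane"
    and pos: "\<And>z. 0 < Re z \<Longrightarrow> 0 < Re (F z)"
    and z: "0 < Re z" and w: "0 < Re w"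
  shows "(norm (F z - F w))\<^sup>2 * (Re z * Re w) \<le> (norm (z - w))\<^sup>2 * (Re (F z) * Re (F w))"
proof -
  \<comment> \<open>\<open>\<phi>\<close> is the inverse of the Cayley map \<open>z \<mapsto> (z - w) / (z + cnj w)\<close>.\<close>
  define \<phi> where "\<phi> = (\<lambda>\<zeta>. (w + cnj w * \<zeta>) / (1 - \<zeta>))"
  define h where "h = (\<lambda>\<zeta>. (F (\<phi> \<zeta>) - F w) / (F (\<phi> \<zeta>) + cnj (F w)))"
  have Re_\<phi>: "0 < Re (\<phi> \<zeta>)" if "norm \<zeta> < 1" for \<zeta>
  proof -
    have "\<zeta> \<noteq> 1" using that by auto
    then have n0: "0 < (norm (1 - \<zeta>))\<^sup>2" by simp
    have "Re (\<phi> \<zeta>) = Re ((w + cnj w * \<zeta>) * cnj (1 - \<zeta>)) / (norm (1 - \<zeta>))\<^sup>2"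
      unfolding \<phi>_def
      by (subst complex_div_cnj) (simp only: Re_divide_of_real flip: of_real_power)
    also have "Re ((w + cnj w * \<zeta>) * cnj (1 - \<zeta>)) = Re w * (1 - (norm \<zeta>)\<^sup>2)"
      unfolding cmod_power2 by (simp add: power2_eq_square algebra_simps)
    finally show ?thesis
      using n0 w that by (simp add: power_less_one_iff abs_square_less_1)
  qed
  have "\<phi> holomorphic_on ball 0 1"
    unfolding \<phi>_def by (intro holomorphic_intros) auto
  moreover have "\<phi> ` ball 0 1 \<subseteq> halfplane" using Re_\<phi> by auto
  ultimately have "(F \<circ> \<phi>) holomorphic_on ball 0 1"
    using hol by (blast intro: holomorphic_on_compose_gen)
  then have holF\<phi>: "(\<lambda>\<zeta>. F (\<phi> \<zeta>)) holomorphic_on ball 0 1" by (simp add: o_def)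
  have nz: "F (\<phi> \<zeta>) + cnj (F w) \<noteq> 0" if "norm \<zeta> < 1" for \<zeta>
    by (intro add_cnj_nonzero pos Re_\<phi> that w)
  have holh: "h holomorphic_on ball 0 1"
    unfolding h_def using nz by (intro holomorphic_intros holF\<phi>) auto
  have h0: "h 0 = 0" by (simp add: h_def \<phi>_def)
  have h1: "norm (h \<zeta>) < 1" if "norm \<zeta> < 1" for \<zeta>
  proof -
    have "(norm (F (\<phi> \<zeta>) - F w))\<^sup>2 < (norm (F (\<phi> \<zeta>) + cnj (F w)))\<^sup>2"
      using pos[OF Re_\<phi>[OF that]] pos[OF w] by (simp add: norm_add_cnj_sq)
    then have "norm (F (\<phi> \<zeta>) - F w) < norm (F (\<phi> \<zeta>) + cnj (F w))"
      by (rule power_less_imp_less_base) simp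
    then show ?thesis unfolding h_def using nz[OF that] by (simp add: norm_divide)
  qed
  define \<zeta> where "\<zeta> = (z - w) / (z + cnj w)"
  have zw: "z + cnj w \<noteq> 0" "w + cnj w \<noteq> 0" by (intro add_cnj_nonzero z w)+
  have "(norm (z - w))\<^sup>2 < (norm (z + cnj w))\<^sup>2" using z w by (simp add: norm_add_cnj_sq)
  then have "norm (z - w) < norm (z + cnj w)" by (rule power_less_imp_less_base) simp
  then have \<zeta>1: "norm \<zeta> < 1" using zw by (simp add: \<zeta>_def norm_divide)
  have "1 - \<zeta> = (w + cnj w) / (z + cnj w)" "w + cnj w * \<zeta> = z * (w + cnj w) / (z + cnj w)"
    using zw by (simp_all add: \<zeta>_def field_simps)
  then have \<phi>\<zeta>: "\<phi> \<zeta> = z" using zw by (simp add: \<phi>_def)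
  have "norm (h \<zeta>) \<le> norm \<zeta>"
    by (rule Schwarz_Lemma(1)[OF holh h0 h1 \<zeta>1])
  then have "norm (F z - F w) * norm (z + cnj w) \<le> norm (z - w) * norm (F z + cnj (F w))"
    using zw nz[OF \<zeta>1] unfolding h_def \<phi>\<zeta> unfolding norm_divide \<zeta>_def
    by (simp add: field_simps)
  then have "(norm (F z - F w) * norm (z + cnj w))\<^sup>2 \<le> (norm (z - w) * norm (F z + cnj (F w)))\<^sup>2"
    by (rule power_mono) simp
  then show ?thesis
    by (simp add: power_mult_distrib norm_add_cnj_sq algebra_simps)
qed

text \<open>
  The form without quotients is closed under limits, so adding a small positive constant to
  \<open>F\<close> extends it to functions whose real part may vanish. This removes the case distinction
  between a positive real part and an imaginary constant whenever \<open>f(q) - q\<close> is studied.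
\<close>

lemma Schwarz_Pick_halfplane:
  assumes hol: "F holomorphic_on halfplane"
    and nonneg: "\<And>z. 0 < Re z \<Longrightarrow> 0 \<le> Re (F z)"
    and z: "0 < Re z" and w: "0 < Re w"
  shows "(norm (F z - F w))\<^sup>2 * (Re z * Re w) \<le> (norm (z - w))\<^sup>2 * (Re (F z) * Re (F w))"
proof (rule tendsto_lowerbound)
  show "((\<lambda>e. (norm (z - w))\<^sup>2 * ((Re (F z) + e) * (Re (F w) + e)))
      \<longlongrightarrow> (norm (z - w))\<^sup>2 * (Re (F z) * Re (F w))) (at_right 0)"
    by (auto intro!: tendsto_eq_intros)
  show "\<forall>\<^sub>F e in at_right 0. (norm (F z - F w))\<^sup>2 * (Re z * Re w)
      \<le> (norm (z - w))\<^sup>2 * ((Re (F z) + e) * (Re (F w) + e))"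
    unfolding eventually_at_right_field
  proof (intro exI[of _ 1] conjI allI impI)
    fix e :: real assume e: "0 < e"
    have "(\<lambda>u. F u + of_real e) holomorphic_on halfplane"
      by (intro holomorphic_intros hol)
    from Schwarz_Pick_halfplane_strict[OF this _ z w]
    show "(norm (F z - F w))\<^sup>2 * (Re z * Re w)
        \<le> (norm (z - w))\<^sup>2 * ((Re (F z) + e) * (Re (F w) + e))"
      using e nonneg by (simp add: add_nonneg_pos)
  qed simp
qed simp

text \<open>
  With \<open>a = Re (F z)\<close>, \<open>b = Re (F w)\<close> and \<open>M = \<bar>z - w\<bar>\<^sup>2 / (Re z * Re w)\<close>, Schwarz-Pick gives
  \<open>(a - b)\<^sup>2 \<le> M a b\<close>, hence \<open>a\<^sup>2 \<le> (M + 2) a b\<close>; a factor \<open>a\<close> cancels.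
\<close>

lemma Harnack_halfplane:
  assumes hol: "F holomorphic_on halfplane"
    and nonneg: "\<And>z. 0 < Re z \<Longrightarrow> 0 \<le> Re (F z)"
    and z: "0 < Re z" and w: "0 < Re w"
  shows "Re (F z) \<le> ((norm (z - w))\<^sup>2 / (Re z * Re w) + 2) * Re (F w)"
proof -
  let ?a = "Re (F z)" and ?b = "Re (F w)" and ?M = "(norm (z - w))\<^sup>2 / (Re z * Re w)"
  have ab: "0 \<le> ?a" "0 \<le> ?b" using nonneg z w by auto
  have "(?a - ?b)\<^sup>2 \<le> (norm (F z - F w))\<^sup>2"
    using abs_Re_le_cmod[of "F z - F w"] by (simp add: abs_le_square_iff[symmetric])
  also have "\<dots> \<le> ?M * (?a * ?b)"
    using Schwarz_Pick_halfplane[OF assms] z w by (simp add: field_simps)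
  finally have "?a * ?a \<le> ?a * ((?M + 2) * ?b)"
    by (simp add: power2_eq_square algebra_simps) (smt (verit) ab mult_nonneg_nonneg)
  moreover have "0 \<le> (?M + 2) * ?b" using ab z w by simp
  ultimately show ?thesis
    using ab by (cases "?a = 0") (auto simp: mult_le_cancel_left)
qed

text \<open>
  Julia's argument with the boundary point at infinity approached along the real axis.
  With \<open>a = Re (F z)\<close> and \<open>R = Re (F x)\<close>, Schwarz-Pick between \<open>z\<close> and a large real \<open>x\<close>
  gives \<open>(R - a)\<^sup>2 x Re z \<le> (\<bar>z\<bar> + x)\<^sup>2 a R\<close>. For \<open>a < x \<le> R\<close> one may replace \<open>R\<close> by \<open>x\<close>
  here, and division by \<open>x\<^sup>2\<close> yields \<open>Re z \<le> a\<close> as \<open>x \<rightarrow> \<infinity>\<close>.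
\<close>

lemma Re_ge_of_Re_ge_on_reals:
  assumes hol: "F holomorphic_on halfplane"
    and pos: "\<And>z. 0 < Re z \<Longrightarrow> 0 \<le> Re (F z)"
    and real: "\<And>x. 0 < x \<Longrightarrow> x \<le> Re (F (of_real x))"
    and z: "0 < Re z"
  shows "Re z \<le> Re (F z)"
proof (rule tendsto_le)
  let ?a = "Re (F z)"
  have bound: "(x - ?a)\<^sup>2 * Re z \<le> (norm z + x)\<^sup>2 * ?a" if x: "?a < x" for x
  proof -
    let ?R = "Re (F (of_real x))"
    have a: "0 \<le> ?a" and x0: "0 < x" using pos z x by (force, smt (verit) pos z)
    then have R: "x \<le> ?R" using real by blast
    \<comment> \<open>The product is the difference \<open>(R - a)\<^sup>2 x - (x - a)\<^sup>2 R\<close>: \<open>(t - a)\<^sup>2 / t\<close> increases for \<open>t \<ge> a\<close>.\<close>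
    have "0 \<le> (?R - x) * (x * ?R - ?a * ?a)"
      using a x R x0 by (intro mult_nonneg_nonneg) (auto intro!: mult_mono)
    then have "(x - ?a)\<^sup>2 * ?R \<le> (?R - ?a)\<^sup>2 * x"
      by (simp add: power2_eq_square algebra_simps)
    then have "(x - ?a)\<^sup>2 * ?R * Re z \<le> (?R - ?a)\<^sup>2 * x * Re z"
      using z by (intro mult_right_mono) auto
    also have "\<dots> \<le> (norm (F z - F (of_real x)))\<^sup>2 * x * Re z"
      using abs_Re_le_cmod[of "F z - F (of_real x)"] x0 z
      by (intro mult_right_mono) (simp_all add: abs_le_square_iff[symmetric] abs_minus_commute)
    also have "\<dots> \<le> (norm (z - of_real x))\<^sup>2 * (?a * ?R)"
      using Schwarz_Pick_halfplane[OF hol pos z, of "of_real x"] x0 by (simp add: mult_ac)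
    also have "\<dots> \<le> (norm z + x)\<^sup>2 * (?a * ?R)"
      using norm_triangle_ineq4[of z "of_real x"] a R x0
      by (intro mult_right_mono power_mono) auto
    finally have "((x - ?a)\<^sup>2 * Re z) * ?R \<le> ((norm z + x)\<^sup>2 * ?a) * ?R"
      by (simp add: mult_ac)
    then show ?thesis using R x0 by simp
  qed
  show "\<forall>\<^sub>F x in at_top. ((x - ?a) / x)\<^sup>2 * Re z \<le> ((norm z + x) / x)\<^sup>2 * ?a"
    using eventually_gt_at_top[of ?a] eventually_gt_at_top[of 0]
  proof eventually_elim
    case (elim x)
    then show ?case using bound[of x] by (simp add: power_divide divide_right_mono)
  qed
  have lim: "((\<lambda>x. ((c + x) / x)) \<longlongrightarrow> 1) at_top" for c :: real
  proof (rule Lim_transform_eventually)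
    show "((\<lambda>x. c / x + 1) \<longlongrightarrow> 1) at_top"
      using tendsto_add[OF tendsto_divide_0[OF tendsto_const[of c]
          filterlim_at_top_imp_at_infinity[OF filterlim_ident]] tendsto_const[of 1]]
      by simp
    show "\<forall>\<^sub>F x in at_top. c / x + 1 = (c + x) / x"
      using eventually_gt_at_top[of 0] by eventually_elim (simp add: field_simps)
  qed
  show "((\<lambda>x. ((x - ?a) / x)\<^sup>2 * Re z) \<longlongrightarrow> Re z) at_top"
    using tendsto_mult_right[OF tendsto_power[OF lim[of "- ?a"], of 2], of "Re z"] by simp
  show "((\<lambda>x. ((norm z + x) / x)\<^sup>2 * ?a) \<longlongrightarrow> ?a) at_top"
    using tendsto_mult_right[OF tendsto_power[OF lim[of "norm z"], of 2], of ?a] by simp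
qed simp

lemma tendsto_divide_one_of_bounded_diff:
  fixes r s :: "nat \<Rightarrow> real"
  assumes r: "filterlim r at_top sequentially"
    and bd: "\<forall>\<^sub>F n in sequentially. \<bar>s n - r n\<bar> \<le> C"
  shows "(\<lambda>n. s n / r n) \<longlonglongrightarrow> 1"
proof -
  have "(\<lambda>n. s n / r n - 1) \<longlonglongrightarrow> 0"
  proof (rule Lim_null_comparison)
    show "\<forall>\<^sub>F n in sequentially. norm (s n / r n - 1) \<le> C / r n"
      using bd filterlim_at_top_dense[THEN iffD1, OF r, rule_format, of 0]
    proof eventually_elim
      case (elim n)
      then have "s n / r n - 1 = (s n - r n) / r n" by (simp add: field_simps)
      then show ?case using elim by (simp add: abs_divide divide_right_mono)
    qed
    show "(\<lambda>n. C / r n) \<longlonglongrightarrow> 0"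
      by (rule tendsto_divide_0[OF tendsto_const filterlim_at_top_imp_at_infinity[OF r]])
  qed
  then show ?thesis by (simp add: Lim_null[of _ 1])
qed

text \<open>
  Julia's argument again, now between a fixed real \<open>x\<close> and the points \<open>z n\<close>, for a sequence of
  functions that is tied together only by its values at \<open>x\<close>. This form is needed because the
  quaternions \<open>q\<^sub>n\<close> lie in varying slices, and the slices meet only in the real axis. After
  division by \<open>\<bar>z n\<bar>\<^sup>2 Re (z n)\<close> every quotient in the Schwarz-Pick inequality tends to \<open>1\<close>; the
  sector condition makes \<open>Re (z n)\<close> tend to infinity.
\<close>

lemma Re_ge_of_tangent_sequence:
  fixes F :: "nat \<Rightarrow> complex \<Rightarrow> complex" and z :: "nat \<Rightarrow> complex"
  assumes hol: "\<And>n. F n holomorphic_on halfplane"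
    and nonneg: "\<And>n z. 0 < Re z \<Longrightarrow> 0 \<le> Re (F n z)"
    and x: "0 < x" and a: "\<And>n. Re (F n (of_real x)) = a"
    and B: "\<And>n. norm (F n (of_real x)) \<le> B"
    and z: "\<And>n. 0 < Re (z n)" and \<gamma>: "0 < \<gamma>" and sect: "\<And>n. \<gamma> * norm (z n) \<le> Re (z n)"
    and inf: "filterlim (\<lambda>n. norm (z n)) at_top sequentially"
    and tang: "(\<lambda>n. F n (z n) - z n) \<longlonglongrightarrow> 0"
  shows "x \<le> a"
proof (rule LIMSEQ_le)
  let ?r = "\<lambda>n. norm (z n)" and ?X = "\<lambda>n. Re (z n)"
  let ?s = "\<lambda>n. norm (F n (of_real x) - F n (z n))" and ?t = "\<lambda>n. norm (of_real x - z n)"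
  have d: "\<forall>\<^sub>F n in sequentially. norm (F n (z n) - z n) < 1"
    using tendstoD[OF tang, of 1] by (simp add: dist_norm)
  have X: "filterlim ?X at_top sequentially"
    by (rule filterlim_at_top_mono[OF filterlim_tendsto_pos_mult_at_top[OF tendsto_const \<gamma> inf]])
      (simp add: sect)
  have s: "(\<lambda>n. ?s n / ?r n) \<longlonglongrightarrow> 1"
  proof (rule tendsto_divide_one_of_bounded_diff[OF inf])
    show "\<forall>\<^sub>F n in sequentially. \<bar>?s n - ?r n\<bar> \<le> B + 1"
      using d
    proof eventually_elim
      case (elim n)
      have "\<bar>?s n - ?r n\<bar> \<le> norm (F n (of_real x) - F n (z n) + z n)"
        using norm_triangle_ineq3[of "F n (of_real x) - F n (z n)" "- z n"] by simp
      also have "\<dots> \<le> norm (F n (of_real x)) + norm (F n (z n) - z n)"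
        using norm_triangle_ineq4[of "F n (of_real x)" "F n (z n) - z n"] by (simp add: algebra_simps)
      finally show ?case using elim B[of n] by linarith
    qed
  qed
  have t: "(\<lambda>n. ?t n / ?r n) \<longlonglongrightarrow> 1"
  proof (rule tendsto_divide_one_of_bounded_diff[OF inf])
    have "\<bar>?t n - ?r n\<bar> \<le> x" for n
      using norm_triangle_ineq3[of "of_real x - z n" "- z n"] x by simp
    then show "\<forall>\<^sub>F n in sequentially. \<bar>?t n - ?r n\<bar> \<le> x" by simp
  qed
  have R: "(\<lambda>n. Re (F n (z n)) / ?X n) \<longlonglongrightarrow> 1"
  proof (rule tendsto_divide_one_of_bounded_diff[OF X])
    show "\<forall>\<^sub>F n in sequentially. \<bar>Re (F n (z n)) - ?X n\<bar> \<le> 1"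
      using d
    proof eventually_elim
      case (elim n)
      then show ?case using abs_Re_le_cmod[of "F n (z n) - z n"] by simp
    qed
  qed
  show "(\<lambda>n. (?s n / ?r n)\<^sup>2 * x) \<longlonglongrightarrow> x"
    using tendsto_mult_right[OF tendsto_power[OF s, of 2], of x] by simp
  show "(\<lambda>n. (?t n / ?r n)\<^sup>2 * (a * (Re (F n (z n)) / ?X n))) \<longlonglongrightarrow> a"
    using tendsto_mult[OF tendsto_power[OF t, of 2] tendsto_mult_left[OF R, of a]] by simp
  have "(?s n / ?r n)\<^sup>2 * x \<le> (?t n / ?r n)\<^sup>2 * (a * (Re (F n (z n)) / ?X n))" for n
  proof -
    have "?s n ^ 2 * (x * ?X n) \<le> ?t n ^ 2 * (a * Re (F n (z n)))"
      using Schwarz_Pick_halfplane[OF hol nonneg, of "of_real x" "z n" n] x z a by simp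
    then have "?s n ^ 2 * (x * ?X n) / (?r n ^ 2 * ?X n)
        \<le> ?t n ^ 2 * (a * Re (F n (z n))) / (?r n ^ 2 * ?X n)"
      using z[of n] by (intro divide_right_mono) auto
    then show ?thesis using z[of n] by (simp add: power_divide)
  qed
  then show "\<exists>N. \<forall>n\<ge>N. (?s n / ?r n)\<^sup>2 * x \<le> (?t n / ?r n)\<^sup>2 * (a * (Re (F n (z n)) / ?X n))"
    by blast
qed

text \<open>
  In a sector, Harnack's inequality bounds the real part at \<open>x\<close> by a constant times \<open>\<bar>z n\<bar>\<close>
  times the real part at \<open>z n\<close>: nonnegative real parts of holomorphic functions cannot decay
  faster than \<open>1 / \<bar>z\<bar>\<close> there, unless they vanish. Again the functions are linked at \<open>x\<close> only.
\<close>

lemma Re_eq_0_of_fast_decay: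
  fixes H :: "nat \<Rightarrow> complex \<Rightarrow> complex" and z :: "nat \<Rightarrow> complex"
  assumes hol: "\<And>n. H n holomorphic_on halfplane"
    and nonneg: "\<And>n z. 0 < Re z \<Longrightarrow> 0 \<le> Re (H n z)"
    and x: "0 < x" and a: "\<And>n. Re (H n (of_real x)) = a"
    and z: "\<And>n. 0 < Re (z n)" and \<gamma>: "0 < \<gamma>" and sect: "\<And>n. \<gamma> * norm (z n) \<le> Re (z n)"
    and inf: "filterlim (\<lambda>n. norm (z n)) at_top sequentially"
    and decay: "(\<lambda>n. norm (z n) * Re (H n (z n))) \<longlonglongrightarrow> 0"
  shows "a = 0"
proof -
  \<comment> \<open>For \<open>\<bar>z n\<bar> \<ge> max 1 x\<close>, the factor \<open>\<bar>x - z\<bar>\<^sup>2 / (x Re z) + 2\<close>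
      of Harnack's inequality is at most \<open>C \<bar>z\<bar>\<close>.\<close>
  define C where "C = 4 / (x * \<gamma>) + 2"
  have "a \<le> C * 0"
  proof (rule tendsto_lowerbound[OF tendsto_mult_left[OF decay]])
    show "\<forall>\<^sub>F n in sequentially. a \<le> C * (norm (z n) * Re (H n (z n)))"
      using inf[unfolded filterlim_at_top, rule_format, of "max 1 x"]
    proof eventually_elim
      case (elim n)
      let ?r = "norm (z n)" and ?b = "Re (H n (z n))"
      have r: "1 \<le> ?r" "x \<le> ?r" using elim by auto
      have b: "0 \<le> ?b" using nonneg z by blast
      have "norm (of_real x - z n) \<le> 2 * ?r"
        using norm_triangle_ineq4[of "of_real x" "z n"] x r by simp
      then have "(norm (of_real x - z n))\<^sup>2 \<le> (2 * ?r)\<^sup>2"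
        by (rule power_mono) simp
      then have "(norm (of_real x - z n))\<^sup>2 / (x * Re (z n)) \<le> (2 * ?r)\<^sup>2 / (x * (\<gamma> * ?r))"
        using x \<gamma> r sect[of n] z[of n] by (intro frac_le mult_left_mono mult_pos_pos) auto
      also have "\<dots> = 4 / (x * \<gamma>) * ?r"
        using r by (simp add: power2_eq_square field_simps)
      finally have "(norm (of_real x - z n))\<^sup>2 / (x * Re (z n)) + 2 \<le> C * ?r"
        unfolding C_def using r by (simp add: distrib_right)
      then have "((norm (of_real x - z n))\<^sup>2 / (x * Re (z n)) + 2) * ?b \<le> C * ?r * ?b"
        by (rule mult_right_mono[OF _ b])
      moreover have "a \<le> ((norm (of_real x - z n))\<^sup>2 / (x * Re (z n)) + 2) * ?b"
        using Harnack_halfplane[OF hol nonneg, of "of_real x" "z n" n] x z a by simp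
      ultimately show ?case by (simp add: mult.assoc)
    qed
  qed simp
  moreover have "0 \<le> a" using nonneg[of "of_real x" 0] a[of 0] x by simp
  ultimately show ?thesis by simp
qed

lemma constant_of_Re_eq_0:
  assumes hol: "H holomorphic_on halfplane"
    and nonneg: "\<And>z. 0 < Re z \<Longrightarrow> 0 \<le> Re (H z)"
    and w: "0 < Re w" "Re (H w) = 0" and z: "0 < Re z"
  shows "H z = H w"
proof -
  have "(norm (H z - H w))\<^sup>2 * (Re z * Re w) \<le> 0"
    using Schwarz_Pick_halfplane[OF hol nonneg z w(1)] w by simp
  moreover have "0 < Re z * Re w" using z w by simp
  ultimately have "(norm (H z - H w))\<^sup>2 \<le> 0" using w z by (auto simp: mult_le_0_iff)
  then show ?thesis by simp
qed

lemma constant_of_constant_on_reals: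
  assumes hol: "F holomorphic_on halfplane"
    and c: "\<And>x::real. 0 < x \<Longrightarrow> F (of_real x) = c" and z: "0 < Re z"
  shows "F z = c"
proof -
  have "F z - c = 0"
  proof (rule analytic_continuation[of "\<lambda>z. F z - c" halfplane "of_real ` {0<..}" 1 z])
    show "(\<lambda>z. F z - c) holomorphic_on halfplane" by (intro holomorphic_intros hol)
    show "(1::complex) islimpt of_real ` {0<..}"
      unfolding islimpt_approachable
    proof (intro allI impI)
      fix e :: real assume "0 < e"
      then show "\<exists>x'\<in>complex_of_real ` {0<..}. x' \<noteq> 1 \<and> dist x' 1 < e"
        by (intro bexI[OF _ imageI[of "1 + e / 2"]]) (auto simp: dist_norm)
    qed
    show "connected halfplane" by (intro convex_connected convex_halfspace_Re_gt)
  qed (use c z open_halfspace_Re_gt in auto)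
  then show ?thesis by simp
qed

section \<open>Holomorphic coordinates on a slice\<close>

lemma inner_quat_mult_left: "inner (I * u) (I * v) = (norm I)\<^sup>2 * inner u (v::quat)"
  by (simp add: inner_quat_def norm_quat_eq power2_eq_square algebra_simps)

lemma imag_unit_iff: "I \<in> imag_units \<longleftrightarrow> qre I = 0 \<and> norm I = 1"
proof
  assume "I \<in> imag_units"
  then have sq: "I * I = -1" by (simp add: imag_units_def power2_eq_square)
  have "norm I * norm I = 1"
    using arg_cong[OF sq, of norm] by (simp add: norm_mult)
  then have n: "norm I = 1" using norm_ge_zero[of I] by (auto simp: square_eq_1_iff)
  then have n': "qre I * qre I + qi I * qi I + qj I * qj I + qk I * qk I = 1"
    by (simp add: norm_quat_eq power2_eq_square)
  have "qre I * qre I - qi I * qi I - qj I * qj I - qk I * qk I = -1"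
    using arg_cong[OF sq, of qre] by simp
  with n' have "qre I * qre I = 0" by linarith
  with n show "qre I = 0 \<and> norm I = 1" by simp
next
  assume a: "qre I = 0 \<and> norm I = 1"
  have "qi I * qi I + qj I * qj I + qk I * qk I = 1"
    using conjunct1[OF a] conjunct2[OF a] by (simp add: norm_quat_eq power2_eq_square)
  with conjunct1[OF a] show "I \<in> imag_units"
    by (simp add: imag_units_def power2_eq_square quat_eq_iff algebra_simps)
qed

lemma imag_unit_components:
  assumes "I \<in> imag_units"
  shows "qre I = 0" "qi I * qi I + qj I * qj I + qk I * qk I = 1"
proof -
  show re: "qre I = 0" using assms by (simp add: imag_unit_iff)
  have "norm I = 1" using assms by (simp add: imag_unit_iff)
  with re show "qi I * qi I + qj I * qj I + qk I * qk I = 1"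
    by (simp add: norm_quat_eq power2_eq_square)
qed

lemma imag_unit_square: "I \<in> imag_units \<Longrightarrow> I * I = -1"
  by (simp add: imag_units_def power2_eq_square)

lemma quat_of_real_sel [simp]:
  "qre (of_real x) = x" "qi (of_real x) = 0" "qj (of_real x) = 0" "qk (of_real x) = 0"
  by (simp_all add: of_real_def)

lemma qre_slice_pt [simp]: "I \<in> imag_units \<Longrightarrow> qre (slice_pt I x y) = x"
  by (simp add: slice_pt_def imag_unit_iff)

lemma slice_pt_real [simp]: "slice_pt I x 0 = of_real x"
  by (simp add: slice_pt_def)

lemma norm_slice_pt:
  assumes "I \<in> imag_units"
  shows "norm (slice_pt I x y) = norm (Complex x y)"
proof -
  note comps = imag_unit_components[OF assms]
  have "y * y * (qi I * qi I + qj I * qj I + qk I * qk I) = y * y"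
    using comps by simp
  then show ?thesis using comps
    by (simp add: slice_pt_def norm_quat_eq cmod_def power2_eq_square algebra_simps)
qed

lemma exists_slice_pt:
  obtains I y where "I \<in> imag_units" "p = slice_pt I (qre p) y"
proof (cases "p = of_real (qre p)")
  case True
  moreover have "Quat 0 1 0 0 \<in> imag_units"
    by (simp add: imag_unit_iff norm_quat_eq)
  ultimately show ?thesis using that[of "Quat 0 1 0 0" 0] by simp
next
  case False
  define v where "v = p - of_real (qre p)"
  have "norm v \<noteq> 0" using False by (simp add: v_def)
  then have "v /\<^sub>R norm v \<in> imag_units"
    by (simp add: imag_unit_iff v_def)
  moreover have "p = slice_pt (v /\<^sub>R norm v) (qre p) (norm v)"
    using \<open>norm v \<noteq> 0\<close> by (simp add: slice_pt_def flip: scaleR_conv_of_real) (simp add: v_def)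
  ultimately show ?thesis using that by blast
qed

text \<open>
  For \<open>u = 1\<close> this is the orthogonal projection of \<open>p\<close> to the complex plane spanned by \<open>1\<close>
  and \<open>I\<close>. In general \<open>p\<close> is paired with \<open>u\<close> and \<open>I u\<close>, because left multiplication by \<open>I\<close>,
  the operation in the Cauchy-Riemann equation, then turns into multiplication by \<open>\<i>\<close>. If \<open>J\<close>
  is an imaginary unit orthogonal to \<open>I\<close>, the choices \<open>u = 1\<close> and \<open>u = J\<close> give the two
  functions of the splitting \<open>f\<^sub>I = F + G J\<close>; allowing every \<open>u\<close> avoids choosing such a \<open>J\<close>.
\<close>

definition slice_coord :: "quat \<Rightarrow> quat \<Rightarrow> quat \<Rightarrow> complex"
  where "slice_coord I u p = Complex (inner u p) (inner (I * u) p)"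

lemma bounded_linear_slice_coord: "bounded_linear (slice_coord I u)"
proof -
  have "slice_coord I u = (\<lambda>p. of_real (inner u p) + \<i> * of_real (inner (I * u) p))"
    by (simp add: slice_coord_def fun_eq_iff complex_eq_iff)
  moreover have "bounded_linear \<dots>"
    by (intro bounded_linear_add bounded_linear_mult_const
        bounded_linear_const_mult bounded_linear_compose[OF bounded_linear_of_real]
        bounded_linear_inner_right)
  ultimately show ?thesis by simp
qed

lemma slice_coord_diff: "slice_coord I u (p - q) = slice_coord I u p - slice_coord I u q"
  by (simp add: slice_coord_def inner_diff_right complex_eq_iff)

lemma norm_slice_coord_le:
  assumes "I \<in> imag_units"
  shows "norm (slice_coord I u p) \<le> 2 * norm u * norm p"
proof -
  have "norm (slice_coord I u p) \<le> \<bar>inner u p\<bar> + \<bar>inner (I * u) p\<bar>"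
    unfolding slice_coord_def using cmod_le[of "Complex (inner u p) (inner (I * u) p)"] by simp
  also have "\<dots> \<le> norm u * norm p + norm (I * u) * norm p"
    by (intro add_mono Cauchy_Schwarz_ineq2)
  also have "norm (I * u) = norm u"
    using assms by (simp add: norm_mult imag_unit_iff)
  finally show ?thesis by (simp add: mult_ac)
qed

lemma slice_coord_mult_imag_unit:
  assumes "I \<in> imag_units"
  shows "slice_coord I u (I * p) = \<i> * slice_coord I u p"
proof -
  have "inner (I * u) (I * p) = inner u p" for p
    using assms by (simp add: inner_quat_mult_left imag_unit_iff)
  moreover have "inner u (I * p) = inner (I * u) (I * (I * p))"
    using calculation[of "I * p"] by simp
  moreover have "I * (I * p) = - p"
    using imag_unit_square[OF assms] by (simp flip: mult.assoc)
  ultimately show ?thesis by (simp add: slice_coord_def complex_eq_iff)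
qed

lemma slice_coord_slice_pt:
  assumes "I \<in> imag_units"
  shows "slice_coord I u (slice_pt I x y) = Complex x y * slice_coord I u 1"
proof -
  interpret bounded_linear "slice_coord I u" by (rule bounded_linear_slice_coord)
  have "slice_pt I x y = x *\<^sub>R 1 + y *\<^sub>R (I * 1)"
    by (simp add: slice_pt_def scaleR_conv_of_real)
  then have "slice_coord I u (slice_pt I x y)
      = x *\<^sub>R slice_coord I u 1 + y *\<^sub>R (\<i> * slice_coord I u 1)"
    by (simp only: add scaleR slice_coord_mult_imag_unit[OF assms])
  then show ?thesis by (simp add: complex_eq_iff algebra_simps)
qed

lemma slice_coord_one_one: "I \<in> imag_units \<Longrightarrow> slice_coord I 1 1 = 1"
  by (simp add: slice_coord_def inner_quat_def complex_eq_iff imag_unit_iff)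

lemma Re_slice_coord_one: "Re (slice_coord I 1 p) = qre p"
  by (simp add: slice_coord_def inner_quat_def)

definition slice_comp :: "(quat \<Rightarrow> quat) \<Rightarrow> quat \<Rightarrow> quat \<Rightarrow> complex \<Rightarrow> complex"
  where "slice_comp f I u z = slice_coord I u (f (slice_pt I (Re z) (Im z)))"

text \<open>
  The splitting lemma. Continuity of the partial derivatives gives total differentiability in
  \<open>(x, y)\<close>. Since \<open>f\<^sub>y = I f\<^sub>x\<close> and \<open>slice_coord I u\<close> carries \<open>I\<close> to \<open>\<i>\<close>, the derivative
  \<open>(s, t) \<mapsto> s D + t (\<i> D)\<close> is multiplication by the complex number \<open>D\<close>.
\<close>

lemma slice_regular_on_holomorphic:
  assumes reg: "slice_regular_on f right_half_space" and I: "I \<in> imag_units"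
  shows "slice_comp f I u holomorphic_on halfplane"
proof -
  let ?X = "{0::real<..}" and ?Y = "UNIV :: real set" and ?c = "slice_coord I u"
  have D: "{(x, y). slice_pt I x y \<in> right_half_space} = ?X \<times> ?Y"
    using I by (auto simp: right_half_space_def)
  obtain fx fy :: "real \<times> real \<Rightarrow> quat" where
    cont: "continuous_on (?X \<times> ?Y) fy" and
    dx: "\<And>x y. 0 < x \<Longrightarrow> ((\<lambda>t. f (slice_pt I t y)) has_vector_derivative fx (x, y)) (at x)" and
    dy: "\<And>x y. 0 < x \<Longrightarrow> ((\<lambda>t. f (slice_pt I x t)) has_vector_derivative fy (x, y)) (at y)" and
    cr: "\<And>x y. 0 < x \<Longrightarrow> fx (x, y) + I * fy (x, y) = 0"
  proof -
    have "\<exists>fx fy :: real \<times> real \<Rightarrow> quat.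
        continuous_on (?X \<times> ?Y) fx \<and> continuous_on (?X \<times> ?Y) fy \<and>
        (\<forall>(x, y)\<in>?X \<times> ?Y.
          ((\<lambda>t. f (slice_pt I t y)) has_vector_derivative fx (x, y)) (at x) \<and>
          ((\<lambda>t. f (slice_pt I x t)) has_vector_derivative fy (x, y)) (at y) \<and>
          (1 / 2) *\<^sub>R (fx (x, y) + I * fy (x, y)) = 0)"
      using reg I unfolding slice_regular_on_def Let_def D[symmetric] by (rule bspec)
    then obtain fx fy :: "real \<times> real \<Rightarrow> quat" where c: "continuous_on (?X \<times> ?Y) fy" and
      d: "\<forall>(x, y)\<in>?X \<times> ?Y.
          ((\<lambda>t. f (slice_pt I t y)) has_vector_derivative fx (x, y)) (at x) \<and>
          ((\<lambda>t. f (slice_pt I x t)) has_vector_derivative fy (x, y)) (at y) \<and>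
          (1 / 2) *\<^sub>R (fx (x, y) + I * fy (x, y)) = 0"
      by blast
    show thesis by (rule that[of fy fx]) (use c d in auto)
  qed
  note bl = bounded_linear_slice_coord[of I u]
  define g where "g = (\<lambda>x y. ?c (f (slice_pt I x y)))"
  have fy_eq: "?c (fy (x, y)) = \<i> * ?c (fx (x, y))" if "0 < x" for x y
  proof -
    \<comment> \<open>Multiplying \<open>f\<^sub>x + I f\<^sub>y = 0\<close> by \<open>I\<close> solves for \<open>f\<^sub>y\<close>.\<close>
    have "I * (fx (x, y) + I * fy (x, y)) = 0" using cr[OF that] by simp
    moreover have "I * (I * fy (x, y)) = - fy (x, y)"
      using imag_unit_square[OF I] by (simp flip: mult.assoc)
    ultimately have "fy (x, y) = I * fx (x, y)" by (simp add: distrib_left)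
    then show ?thesis using slice_coord_mult_imag_unit[OF I] by simp
  qed
  have "(slice_comp f I u has_field_derivative ?c (fx (Re z, Im z))) (at z)" if z: "0 < Re z" for z
  proof -
    let ?D = "?c (fx (Re z, Im z))"
    have "((\<lambda>(x, y). g x y) has_derivative
        (\<lambda>(s, t). s *\<^sub>R ?D + blinfun_scaleR_left (?c (fy (Re z, Im z))) t))
        (at (Re z, Im z) within ?X \<times> ?Y)"
    proof (rule has_derivative_partialsI)
      show "((\<lambda>x. g x (Im z)) has_derivative (\<lambda>s. s *\<^sub>R ?D)) (at (Re z) within ?X)"
        using bounded_linear.has_vector_derivative[OF bl dx[OF z, of "Im z"]]
        unfolding g_def has_vector_derivative_def by (rule has_derivative_at_withinI)
      show "(g x has_derivative blinfun_apply (blinfun_scaleR_left (?c (fy (x, y)))))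
          (at y within ?Y)" if "x \<in> ?X" for x y
        using bounded_linear.has_vector_derivative[OF bl dy[of x y]] that
        unfolding g_def has_vector_derivative_def by simp
      have "continuous_on (?X \<times> ?Y) (\<lambda>p. blinfun_scaleR_left (?c (fy p)))"
        by (intro bounded_linear.continuous_on[OF bounded_linear_blinfun_scaleR_left]
            bounded_linear.continuous_on[OF bl] cont)
      then show "continuous (at (Re z, Im z) within ?X \<times> ?Y)
          (\<lambda>(x, y). blinfun_scaleR_left (?c (fy (x, y))))"
        using z by (simp add: continuous_on_eq_continuous_within case_prod_unfold)
    qed auto
    moreover have "open (?X \<times> ?Y)" by (intro open_Times) auto
    ultimately have "((\<lambda>(x, y). g x y) has_derivative
        (\<lambda>(s, t). s *\<^sub>R ?D + t *\<^sub>R (\<i> * ?D))) (at (Re z, Im z))"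
      using z by (simp add: at_within_open[of _ "?X \<times> ?Y"] fy_eq)
    moreover have "((\<lambda>z. (Re z, Im z)) has_derivative (\<lambda>z. (Re z, Im z))) (at z)"
      by (auto intro!: derivative_eq_intros)
    ultimately have "((\<lambda>(x, y). g x y) \<circ> (\<lambda>z. (Re z, Im z)) has_derivative
        (\<lambda>(s, t). s *\<^sub>R ?D + t *\<^sub>R (\<i> * ?D)) \<circ> (\<lambda>z. (Re z, Im z))) (at z)"
      using diff_chain_at by blast
    moreover have "(\<lambda>(x, y). g x y) \<circ> (\<lambda>z. (Re z, Im z)) = slice_comp f I u"
      by (simp add: fun_eq_iff g_def slice_comp_def)
    moreover have "(\<lambda>(s, t). s *\<^sub>R ?D + t *\<^sub>R (\<i> * ?D)) \<circ> (\<lambda>z. (Re z, Im z)) = (*) ?D"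
      by (simp add: fun_eq_iff complex_eq_iff algebra_simps)
    ultimately show ?thesis by (simp add: has_field_derivative_def)
  qed
  then show ?thesis
    by (intro holomorphic_onI) (auto simp: field_differentiable_def
        intro: has_field_derivative_at_within)
qed

lemma slice_comp_of_real [simp]: "slice_comp f I u (of_real x) = slice_coord I u (f (of_real x))"
  by (simp add: slice_comp_def)

lemma Re_slice_comp_one: "Re (slice_comp f I 1 z) = qre (f (slice_pt I (Re z) (Im z)))"
  by (simp add: slice_comp_def Re_slice_coord_one)

lemma slice_comp_diff_id:
  assumes "I \<in> imag_units"
  shows "slice_comp (\<lambda>p. f p - p) I u = (\<lambda>z. slice_comp f I u z - z * slice_coord I u 1)"
  using assms by (simp add: fun_eq_iff slice_comp_def slice_coord_diff slice_coord_slice_pt)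

text \<open>
  All slices contain the positive real axis, so the identity theorem applied to each coordinate
  on each slice propagates a constant from there to the whole half space.
\<close>

lemma slice_constant_of_constant_on_reals:
  assumes hol: "\<And>I u. I \<in> imag_units \<Longrightarrow> slice_comp g I u holomorphic_on halfplane"
    and v: "\<And>x. 0 < x \<Longrightarrow> g (of_real x) = v" and p: "p \<in> right_half_space"
  shows "g p = v"
proof -
  obtain I y where I: "I \<in> imag_units" and py: "p = slice_pt I (qre p) y"
    by (rule exists_slice_pt)
  have "slice_comp g I u (Complex (qre p) y) = slice_coord I u v" for u
    by (rule constant_of_constant_on_reals[OF hol[OF I]])
      (use p in \<open>simp_all add: v right_half_space_def\<close>)
  then have "inner u (g p) = inner u v" for u
    unfolding slice_comp_def slice_coord_def complex.sel py[symmetric] by simp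
  then show ?thesis by (metis vector_eq_ldot)
qed

section \<open>Rigidity at infinity\<close>

theorem theorem11:
  fixes f :: "quat \<Rightarrow> quat" and q :: "nat \<Rightarrow> quat" and \<gamma> :: real
  assumes "f \<in> right_half_space \<rightarrow> right_half_space"
    and "slice_regular_on f right_half_space"
    and "0 < \<gamma>" and "\<gamma> < 1"
    and "\<And>n. q n \<in> sector \<gamma>"
    and "filterlim (\<lambda>n. norm (q n)) at_top sequentially"
    and "(\<lambda>n. norm (q n) * norm (f (q n) - q n)) \<longlonglongrightarrow> 0"
  shows "\<forall>p\<in>right_half_space. f p = p"
proof -
  \<comment> \<open>The aim is to show that \<open>g\<close> is constant: \<open>g (q n)\<close> tends to \<open>0\<close>.\<close>
  define g where "g = (\<lambda>p. f p - p)"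
  have f_pos: "0 < qre (f (slice_pt I (Re z) (Im z)))" if "I \<in> imag_units" "0 < Re z" for I z
    using assms(1) that by (auto simp: right_half_space_def)
  have f_hol: "slice_comp f I u holomorphic_on halfplane" if "I \<in> imag_units" for I u
    by (rule slice_regular_on_holomorphic[OF assms(2) that])
  have g_hol: "slice_comp g I u holomorphic_on halfplane" if "I \<in> imag_units" for I u
    unfolding g_def slice_comp_diff_id[OF that] by (intro holomorphic_intros f_hol that)
  have "\<exists>I y. I \<in> imag_units \<and> q n = slice_pt I (qre (q n)) y" for n
    by (metis exists_slice_pt)
  then obtain J y where J: "\<And>n. J n \<in> imag_units"
    and q_eq: "\<And>n. q n = slice_pt (J n) (qre (q n)) (y n)"
    by metis
  define z where "z = (\<lambda>n. Complex (qre (q n)) (y n))"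
  have norm_z: "norm (z n) = norm (q n)" for n
    using norm_slice_pt[OF J[of n], of "qre (q n)" "y n"] q_eq[of n, symmetric] by (simp add: z_def)
  have z_pos: "0 < Re (z n)" and z_sector: "\<gamma> * norm (z n) \<le> Re (z n)" for n
    unfolding norm_z using assms(5)[of n] by (simp_all add: z_def sector_def right_half_space_def)
  have z_inf: "filterlim (\<lambda>n. norm (z n)) at_top sequentially"
    unfolding norm_z by (rule assms(6))
  have decay: "(\<lambda>n. norm (q n) * norm (g (q n))) \<longlonglongrightarrow> 0"
    using assms(7) by (simp add: g_def)
  have g_lim: "(\<lambda>n. norm (g (q n))) \<longlonglongrightarrow> 0"
  proof (rule Lim_null_comparison[OF _ decay])
    show "\<forall>\<^sub>F n in sequentially. norm (norm (g (q n))) \<le> norm (q n) * norm (g (q n))"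
      using assms(6)[unfolded filterlim_at_top, rule_format, of 1]
      by eventually_elim (simp add: mult_le_cancel_right1)
  qed
  have comp_q: "slice_comp h (J n) u (z n) = slice_coord (J n) u (h (q n))" for h n u
    using q_eq[of n, symmetric] by (simp add: slice_comp_def z_def)

  \<comment> \<open>On the real axis the real part of \<open>slice_comp f I 1\<close> is that of \<open>f\<close>, whatever \<open>I\<close> is.\<close>
  have f_real: "x \<le> qre (f (of_real x))" if x: "0 < x" for x
  proof (rule Re_ge_of_tangent_sequence[of "\<lambda>n. slice_comp f (J n) 1" x _ "2 * norm (f (of_real x))" z \<gamma>])
    show "norm (slice_comp f (J n) 1 (of_real x)) \<le> 2 * norm (f (of_real x))" for n
      using norm_slice_coord_le[OF J, of n 1 "f (of_real x)"] by simp
    show "(\<lambda>n. slice_comp f (J n) 1 (z n) - z n) \<longlonglongrightarrow> 0"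
    proof (rule Lim_null_comparison)
      show "(\<lambda>n. 2 * norm (g (q n))) \<longlonglongrightarrow> 0"
        using tendsto_mult_left[OF g_lim, of 2] by simp
      have "slice_comp f (J n) 1 (z n) - z n = slice_coord (J n) 1 (g (q n))" for n
        using slice_comp_diff_id[OF J, of f n 1] comp_q[of g n 1]
        by (simp add: g_def slice_coord_one_one[OF J])
      then show "\<forall>\<^sub>F n in sequentially. norm (slice_comp f (J n) 1 (z n) - z n)
          \<le> 2 * norm (g (q n))"
        using norm_slice_coord_le[OF J, of _ 1] by simp
    qed
  qed (use f_pos[OF J] f_hol[OF J] x z_pos assms(3) z_sector z_inf in
      \<open>simp_all add: Re_slice_comp_one less_imp_le Re_slice_coord_one\<close>)
  have g_nonneg: "0 \<le> Re (slice_comp g I 1 z)" if I: "I \<in> imag_units" and z: "0 < Re z" for I z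
  proof -
    have "Re z \<le> Re (slice_comp f I 1 z)"
      by (rule Re_ge_of_Re_ge_on_reals[OF f_hol[OF I] _ _ z])
        (use f_pos[OF I] f_real in \<open>simp_all add: Re_slice_comp_one less_imp_le Re_slice_coord_one\<close>)
    then show ?thesis
      by (simp add: g_def slice_comp_diff_id[OF I] slice_coord_one_one[OF I])
  qed
  have g_real: "qre (g (of_real x)) = 0" if x: "0 < x" for x
  proof (rule Re_eq_0_of_fast_decay[of "\<lambda>n. slice_comp g (J n) 1" x _ z \<gamma>])
    show "(\<lambda>n. norm (z n) * Re (slice_comp g (J n) 1 (z n))) \<longlonglongrightarrow> 0"
    proof (rule Lim_null_comparison[OF _ decay])
      have "\<bar>qre p\<bar> \<le> norm p" for p :: quat
        unfolding norm_quat_eq by (rule real_le_rsqrt) simp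
      then show "\<forall>\<^sub>F n in sequentially. norm (norm (z n) * Re (slice_comp g (J n) 1 (z n)))
          \<le> norm (q n) * norm (g (q n))"
        by (simp add: norm_z comp_q Re_slice_coord_one abs_mult mult_left_mono)
    qed
  qed (use g_nonneg[OF J] g_hol[OF J] x z_pos assms(3) z_sector z_inf in
      \<open>simp_all add: Re_slice_coord_one\<close>)
  \<comment> \<open>The real part of \<open>g\<close> vanishes on the real axis, so the projection of \<open>g\<close> to each
      slice is constant there; letting \<open>I\<close> vary recovers all coordinates of \<open>g\<close>.\<close>
  have g_one: "g (of_real x) = g 1" if x: "0 < x" for x
  proof -
    have I: "inner I (g (of_real x)) = inner I (g 1)" if I: "I \<in> imag_units" for I
    proof -
      have "slice_comp g I 1 (of_real x) = slice_comp g I 1 (of_real 1)"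
        by (rule constant_of_Re_eq_0[OF g_hol[OF I] g_nonneg[OF I]])
          (use x g_real[of 1] in \<open>simp_all add: Re_slice_coord_one del: of_real_1\<close>)
      then show ?thesis
        unfolding slice_comp_of_real slice_coord_def by simp
    qed
    have "Quat 0 1 0 0 \<in> imag_units" "Quat 0 0 1 0 \<in> imag_units" "Quat 0 0 0 1 \<in> imag_units"
      by (simp_all add: imag_unit_iff norm_quat_eq)
    from this[THEN I] show ?thesis
      using g_real[OF x] g_real[of 1] by (simp add: quat_eq_iff inner_quat_def)
  qed
  have g_const: "g p = g 1" if "p \<in> right_half_space" for p
    by (rule slice_constant_of_constant_on_reals[OF g_hol g_one that])
  have "g (q n) = g 1" for n
    using assms(5)[of n] by (intro g_const) (simp add: sector_def)
  then have "norm (g 1) = 0"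
    using g_lim by (simp add: LIMSEQ_const_iff)
  then show ?thesis
    using g_const by (simp add: g_def)
qed

end
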